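(* Let $U$ be a VLA-J-SS. Then $U$ satisfies the half Jacobi identity if and only if it satisfies the half associator formula: for all homogeneous $u,v,w\in U$ and all $k,n\in\mathbb{N}$, $$(u_kv)_nw=\sum_{i\ge0}(-1)^i\binom{k}{i}\big(u_{k-i}(v_{n+i}w)-\varepsilon_{u,v}(-1)^kv_{n+k-i}(u_iw)\big).$$
   Context: All spaces over $\mathbb{C}$; $\mathbb{N}=\{0,1,2,\dots\}$; $\varepsilon_{u,v}=(-1)^{|u||v|}$. A VLA-J-SS is a $\mathbb{Z}_2$-graded space $U$ with an even linear operator $D$ and bilinear products $u_nv$ ($n\in\mathbb{N}$) such that for homogeneous $u,v$: $u_nv=0$ for $n$ large; $(Du)_nv=-nu_{n-1}v$ (read as $0$ for $n=0$); $D(u_nv)=(Du)_nv+u_n(Dv)$; $|u_nv|=|u|+|v|$. The half Jacobi identity is: for all homogeneous $u,v,w\in U$ and all $k,m,n\in\mathbb{N}$, $\sum_{i\ge0}(-1)^i\binom{k}{i}(u_{m+k-i}(v_{n+i}w)-\varepsilon_{u,v}(-1)^kv_{n+k-i}(u_{m+i}w))=\sum_{i\ge0}\binom{m}{i}(u_{k+i}v)_{m+n-i}w$. *)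

theory Defs
  imports Complex_Main
begin

text \<open>A Z2-graded complex vector space is modelled by a carrier type 'a with a
 complex scalar multiplication sc making it a vector space, together with the
 two homogeneous components G False (even) and G True (odd).
 prd n u v stands for the n-th product u_n v.\<close>

definition eps :: "bool \<Rightarrow> bool \<Rightarrow> complex" where
  "eps p q = (if p \<and> q then -1 else 1)"

definition VLA_J_SS ::
  "(complex \<Rightarrow> 'a::ab_group_add \<Rightarrow> 'a) \<Rightarrow> (bool \<Rightarrow> 'a set) \<Rightarrow> ('a \<Rightarrow> 'a)
    \<Rightarrow> (nat \<Rightarrow> 'a \<Rightarrow> 'a \<Rightarrow> 'a) \<Rightarrow> bool" where
  "VLA_J_SS sc G D prd \<longleftrightarrow>
     vector_space sc
   \<and> (\<forall>p. module.subspace sc (G p))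
   \<and> (\<forall>x. \<exists>!ab. fst ab \<in> G False \<and> snd ab \<in> G True \<and> x = fst ab + snd ab)
   \<and> Vector_Spaces.linear sc sc D
   \<and> (\<forall>p. D ` G p \<subseteq> G p)
   \<and> (\<forall>n v. Vector_Spaces.linear sc sc (\<lambda>u. prd n u v))
   \<and> (\<forall>n u. Vector_Spaces.linear sc sc (\<lambda>v. prd n u v))
   \<and> (\<forall>p q u v. u \<in> G p \<longrightarrow> v \<in> G q \<longrightarrow>
        (\<exists>N. \<forall>n\<ge>N. prd n u v = 0)
      \<and> prd 0 (D u) v = 0
      \<and> (\<forall>n. prd (Suc n) (D u) v = sc (- of_nat (Suc n)) (prd n u v))
      \<and> (\<forall>n. D (prd n u v) = prd n (D u) v + prd n u (D v))
      \<and> (\<forall>n. prd n u v \<in> G (p \<noteq> q)))"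

definition half_jacobi ::
  "(complex \<Rightarrow> 'a::ab_group_add \<Rightarrow> 'a) \<Rightarrow> (bool \<Rightarrow> 'a set)
    \<Rightarrow> (nat \<Rightarrow> 'a \<Rightarrow> 'a \<Rightarrow> 'a) \<Rightarrow> bool" where
  "half_jacobi sc G prd \<longleftrightarrow>
    (\<forall>p q r u v w k m n. u \<in> G p \<longrightarrow> v \<in> G q \<longrightarrow> w \<in> G r \<longrightarrow>
       (\<Sum>i\<le>k. sc ((-1)^i * of_nat (k choose i))
          (prd (m + k - i) u (prd (n + i) v w)
           - sc (eps p q * (-1)^k) (prd (n + k - i) v (prd (m + i) u w))))
     = (\<Sum>i\<le>m. sc (of_nat (m choose i)) (prd (m + n - i) (prd (k + i) u v) w)))"

definition half_associator ::
  "(complex \<Rightarrow> 'a::ab_group_add \<Rightarrow> 'a) \<Rightarrow> (bool \<Rightarrow> 'a set)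
    \<Rightarrow> (nat \<Rightarrow> 'a \<Rightarrow> 'a \<Rightarrow> 'a) \<Rightarrow> bool" where
  "half_associator sc G prd \<longleftrightarrow>
    (\<forall>p q r u v w k n. u \<in> G p \<longrightarrow> v \<in> G q \<longrightarrow> w \<in> G r \<longrightarrow>
       prd n (prd k u v) w
     = (\<Sum>i\<le>k. sc ((-1)^i * of_nat (k choose i))
          (prd (k - i) u (prd (n + i) v w)
           - sc (eps p q * (-1)^k) (prd (n + k - i) v (prd i u w)))))"

end

theory Submission
  imports Defs
begin

text \<open>Write \<open>J(k,m,n)\<close> and \<open>R(k,m,n)\<close> for the two sides of the half Jacobi identity.
  Pascal's rule for the binomial coefficients shows that both satisfy the recurrence
  \<open>X(k,m+1,n) = X(k+1,m,n) + X(k,m,n+1)\<close>, which determines \<open>X\<close> from its values at \<open>m = 0\<close>.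
  Since the half associator formula is exactly the case \<open>m = 0\<close> of the half Jacobi identity,
  the two are equivalent.\<close>

lemma pascal_recurrence_unique:
  fixes X Y :: "nat \<Rightarrow> nat \<Rightarrow> nat \<Rightarrow> 'a::plus"
  assumes X_Suc: "\<And>k m n. X k (Suc m) n = X (Suc k) m n + X k m (Suc n)"
    and Y_Suc: "\<And>k m n. Y k (Suc m) n = Y (Suc k) m n + Y k m (Suc n)"
    and X_Y_0: "\<And>k n. X k 0 n = Y k 0 n"
  shows "X k m n = Y k m n"
proof (induction m arbitrary: k n)
  case 0
  show ?case by (rule X_Y_0)
next
  case (Suc m)
  then show ?case by (simp add: X_Suc Y_Suc)
qed

text \<open>With \<open>f a b = u\<^sub>a (v\<^sub>b w)\<close>, \<open>g a b = v\<^sub>a (u\<^sub>b w)\<close> and \<open>h a b = (u\<^sub>a v)\<^sub>b w\<close>,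
  \<open>jacobi_sum sc f g (eps p q) k m n\<close> and \<open>binomial_sum sc h k m n\<close> are the two sides
  of the half Jacobi identity.\<close>

definition alternating_binomial_sum ::
    "('s::comm_ring_1 \<Rightarrow> 'v \<Rightarrow> 'v::ab_group_add) \<Rightarrow> (nat \<Rightarrow> nat \<Rightarrow> 'v) \<Rightarrow> nat \<Rightarrow> nat \<Rightarrow> nat \<Rightarrow> 'v" where
  "alternating_binomial_sum sc f k m n =
     (\<Sum>i\<le>k. sc ((-1)^i * of_nat (k choose i)) (f (m + k - i) (n + i)))"

definition jacobi_sum ::
    "('s::comm_ring_1 \<Rightarrow> 'v \<Rightarrow> 'v::ab_group_add) \<Rightarrow> (nat \<Rightarrow> nat \<Rightarrow> 'v) \<Rightarrow> (nat \<Rightarrow> nat \<Rightarrow> 'v)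
      \<Rightarrow> 's \<Rightarrow> nat \<Rightarrow> nat \<Rightarrow> nat \<Rightarrow> 'v" where
  "jacobi_sum sc f g c k m n =
     (\<Sum>i\<le>k. sc ((-1)^i * of_nat (k choose i))
        (f (m + k - i) (n + i) - sc (c * (-1)^k) (g (n + k - i) (m + i))))"

definition binomial_sum ::
    "('s::comm_ring_1 \<Rightarrow> 'v \<Rightarrow> 'v::ab_group_add) \<Rightarrow> (nat \<Rightarrow> nat \<Rightarrow> 'v) \<Rightarrow> nat \<Rightarrow> nat \<Rightarrow> nat \<Rightarrow> 'v" where
  "binomial_sum sc h k m n = (\<Sum>i\<le>m. sc (of_nat (m choose i)) (h (k + i) (m + n - i)))"

context module
begin

lemma sum_choose_Suc_scale:
  "(\<Sum>i\<le>Suc k. of_nat (Suc k choose i) *s x i)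
   = (\<Sum>i\<le>k. of_nat (k choose i) *s x i) + (\<Sum>i\<le>k. of_nat (k choose i) *s x (Suc i))"
proof -
  have shift: "(\<Sum>i\<le>k. of_nat (k choose i) *s x i)
      = x 0 + (\<Sum>i\<le>k. of_nat (k choose Suc i) *s x (Suc i))"
  proof -
    have "(\<Sum>i\<le>k. of_nat (k choose i) *s x i) = (\<Sum>i\<le>Suc k. of_nat (k choose i) *s x i)"
      by (simp add: binomial_eq_0)
    also have "\<dots> = x 0 + (\<Sum>i\<le>k. of_nat (k choose Suc i) *s x (Suc i))"
      by (subst sum.atMost_Suc_shift) simp
    finally show ?thesis .
  qed
  have "(\<Sum>i\<le>Suc k. of_nat (Suc k choose i) *s x i)
      = x 0 + (\<Sum>i\<le>k. of_nat (Suc k choose Suc i) *s x (Suc i))"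
    by (subst sum.atMost_Suc_shift) simp
  also have "\<dots> = (x 0 + (\<Sum>i\<le>k. of_nat (k choose Suc i) *s x (Suc i)))
      + (\<Sum>i\<le>k. of_nat (k choose i) *s x (Suc i))"
    by (simp add: scale_left_distrib sum.distrib algebra_simps)
  finally show ?thesis
    unfolding shift .
qed

lemma alternating_binomial_sum_Suc:
  "alternating_binomial_sum (*s) f k (Suc m) n
   = alternating_binomial_sum (*s) f (Suc k) m n + alternating_binomial_sum (*s) f k m (Suc n)"
proof -
  have "alternating_binomial_sum (*s) f (Suc k) m n
      = (\<Sum>i\<le>Suc k. of_nat (Suc k choose i) *s ((-1)^i *s f (m + Suc k - i) (n + i)))"
    unfolding alternating_binomial_sum_def by (simp add: mult.commute)
  also have "\<dots> = alternating_binomial_sum (*s) f k (Suc m) n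
      - alternating_binomial_sum (*s) f k m (Suc n)"
    unfolding sum_choose_Suc_scale alternating_binomial_sum_def
    by (simp add: mult.commute sum_negf[symmetric])
  finally show ?thesis by simp
qed

lemma binomial_sum_Suc:
  "binomial_sum (*s) h k (Suc m) n
   = binomial_sum (*s) h (Suc k) m n + binomial_sum (*s) h k m (Suc n)"
  unfolding binomial_sum_def by (subst sum_choose_Suc_scale) (simp add: add.commute)

lemma jacobi_sum_eq:
  "jacobi_sum (*s) f g c k m n
   = alternating_binomial_sum (*s) f k m n - (c * (-1)^k) *s alternating_binomial_sum (*s) g k n m"
  unfolding jacobi_sum_def alternating_binomial_sum_def
  by (simp add: scale_right_diff_distrib scale_sum_right sum_subtractf ac_simps)

lemma jacobi_sum_Suc:
  "jacobi_sum (*s) f g c k (Suc m) n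
   = jacobi_sum (*s) f g c (Suc k) m n + jacobi_sum (*s) f g c k m (Suc n)"
proof -
  \<comment> \<open>In the \<open>g\<close>-part \<open>m\<close> and \<open>n\<close> are swapped, so the recurrence appears with a minus sign,
    which the factor \<open>(-1)^k\<close> absorbs.\<close>
  have "alternating_binomial_sum (*s) g k n (Suc m)
      = alternating_binomial_sum (*s) g k (Suc n) m - alternating_binomial_sum (*s) g (Suc k) n m"
    by (simp add: alternating_binomial_sum_Suc)
  then show ?thesis
    unfolding jacobi_sum_eq alternating_binomial_sum_Suc
    by (simp add: scale_right_diff_distrib algebra_simps)
qed

lemma jacobi_sum_eq_binomial_sumI:
  assumes "\<And>k n. jacobi_sum (*s) f g c k 0 n = binomial_sum (*s) h k 0 n"
  shows "jacobi_sum (*s) f g c k m n = binomial_sum (*s) h k m n"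
  using jacobi_sum_Suc binomial_sum_Suc assms by (rule pascal_recurrence_unique)

end

theorem lemma6p2:
  fixes sc :: "complex \<Rightarrow> 'a::ab_group_add \<Rightarrow> 'a"
    and G :: "bool \<Rightarrow> 'a set" and D :: "'a \<Rightarrow> 'a"
    and prd :: "nat \<Rightarrow> 'a \<Rightarrow> 'a \<Rightarrow> 'a"
  assumes "VLA_J_SS sc G D prd"
  shows "half_jacobi sc G prd \<longleftrightarrow> half_associator sc G prd"
proof -
  interpret vector_space sc
    using assms unfolding VLA_J_SS_def by blast
  have half_jacobi_iff: "half_jacobi sc G prd \<longleftrightarrow>
      (\<forall>p q r u v w. u \<in> G p \<longrightarrow> v \<in> G q \<longrightarrow> w \<in> G r \<longrightarrow> (\<forall>k m n.
        jacobi_sum sc (\<lambda>a b. prd a u (prd b v w)) (\<lambda>a b. prd a v (prd b u w)) (eps p q) k m n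
        = binomial_sum sc (\<lambda>a b. prd b (prd a u v) w) k m n))"
    unfolding half_jacobi_def jacobi_sum_def binomial_sum_def by blast
  have half_associator_iff: "half_associator sc G prd \<longleftrightarrow>
      (\<forall>p q r u v w. u \<in> G p \<longrightarrow> v \<in> G q \<longrightarrow> w \<in> G r \<longrightarrow> (\<forall>k n.
        jacobi_sum sc (\<lambda>a b. prd a u (prd b v w)) (\<lambda>a b. prd a v (prd b u w)) (eps p q) k 0 n
        = binomial_sum sc (\<lambda>a b. prd b (prd a u v) w) k 0 n))"
    unfolding half_associator_def jacobi_sum_def binomial_sum_def by auto
  show ?thesis
    unfolding half_jacobi_iff half_associator_iff
    by (auto intro: jacobi_sum_eq_binomial_sumI)
qed

end
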